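(* Let $H=(U,\mathcal{C})$ be a hypergraph with dual hypergraph $H^*$, and let $\mathcal{X}=\prod_{u\in U}\mathcal{X}_u$, where $\mathcal{X}_u$ is the finite set of values of a discrete variable $X_u$. Then there is a one-to-one correspondence between the graphical models $\mathscr{G}(H,\mathcal{X})$ and the tensor hypernetwork states $\mathscr{T}(H^*,\{|\mathcal{X}_u|:u\in U\})$, up to global scaling constant.
   Context: A hypergraph $H=(U,\mathcal{C})$ consists of a set $U$ of vertices and a set $\mathcal{C}$ of hyperedges, each a subset of $U$ (nested or repeated hyperedges, and hyperedges with one or no vertices, are allowed). The dual hypergraph $H^*$ has vertices $\{v_C: C\in\mathcal{C}\}$ and hyperedges $\{e_u: u\in U\}$, with $v_C\in e_u$ if and only if $u\in C$; its incidence matrix is the transpose of that of $H$. $\mathscr{G}(H,\mathcal{X})$ denotes the set of distributions $P$ on $\mathcal{X}$ in the graphical model defined by $H$, i.e. those that factor as $P(x)=\frac1Z\prod_{C\in\mathcal{C}}\psi_C(x_C)$, where $x_C=(x_u)_{u\in C}$, each clique potential $\psi_C$ is a function on $\prod_{u\in C}\mathcal{X}_u$ (equivalently a tensor of format $\times_{u\in C}|\mathcal{X}_u|$), and $Z$ is the normalizing constant making the entries sum to one. Clique potentials are required to take values in $\mathbb{R}_{\ge 0}$ for probabilistic reasons, but the definition and factorization structure of graphical models is also used with $\psi_C$ taking values in a general field $\mathbb{K}$. A tensor hypernetwork on a hypergraph $G=(V,E)$ with sizes $\mathbf{n}=\{n_e:e\in E\}$ (positive integers) assigns to each vertex $v\in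 V$ a tensor $T_v\in\bigotimes_{e\ni v}\mathbb{K}^{n_e}$, where $\mathbb{K}$ is usually $\mathbb{R}$ or $\mathbb{C}$. Its non-contracted state is the tensor, before contracting any hyperedges, with entries $\prod_{v\in V}(T_v)_{(i_e)_{e\ni v}}$ indexed by $(i_e)_{e\in E}\in\prod_{e\in E}\{1,\dots,n_e\}$. $\mathscr{T}(G,\mathbf{n})$ denotes the set of non-contracted tensor hypernetwork states from $G$ with sizes $\mathbf{n}$. In $\mathscr{T}(H^*,\{|\mathcal{X}_u|:u\in U\})$ the hyperedge $e_u$ of $H^*$ has size $|\mathcal{X}_u|$. The graphical model with clique potentials $\psi_C$ on $H$ corresponds to the tensor hypernetwork on $H^*$ with the tensor $T_C=\psi_C$ at each vertex $v_C$, for which $Z\cdot P(x)=\prod_{C\in\mathcal{C}}(T_C)_{x_C}$. *)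

theory Defs
  imports Complex_Main "HOL-Library.FuncSet"
begin

text \<open>
  Hyperedges are labels with an assigned vertex set, so that repeated, nested, singleton and
  empty hyperedges are all possible.
\<close>

record ('v, 'e) hypergraph =
  verts :: "'v set"
  hedges :: "'e set"
  members :: "'e \<Rightarrow> 'v set"

definition finite_hypergraph :: "('v, 'e) hypergraph \<Rightarrow> bool" where
  "finite_hypergraph H \<longleftrightarrow>
     finite (verts H) \<and> finite (hedges H) \<and> (\<forall>C\<in>hedges H. members H C \<subseteq> verts H)"

definition dual :: "('v, 'e) hypergraph \<Rightarrow> ('e, 'v) hypergraph" where
  "dual H = \<lparr>verts = hedges H, hedges = verts H,
             members = (\<lambda>u. {C \<in> hedges H. u \<in> members H C})\<rparr>"


section \<open>Graphical models\<close>

text \<open>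
  Below, \<open>S\<close> is the set of admissible values of clique potentials and of tensor entries:
  the nonnegative reals in the probabilistic setting, or an entire field.
  A joint state \<open>x\<close> is an extensional function, and \<open>restrict x C\<close> plays the role of
  the tuple of the \<open>x u\<close> with \<open>u\<close> in \<open>C\<close>.
\<close>

definition joint_states :: "('u, 'c) hypergraph \<Rightarrow> ('u \<Rightarrow> 'x set) \<Rightarrow> ('u \<Rightarrow> 'x) set" where
  "joint_states H X = PiE (verts H) X"

definition clique_potentials ::
  "'k set \<Rightarrow> ('u, 'c) hypergraph \<Rightarrow> ('u \<Rightarrow> 'x set) \<Rightarrow> ('c \<Rightarrow> ('u \<Rightarrow> 'x) \<Rightarrow> 'k) set" where
  "clique_potentials S H X = (\<Pi> C\<in>hedges H. PiE (members H C) X \<rightarrow> S)"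

definition potential_product ::
  "('u, 'c) hypergraph \<Rightarrow> ('u \<Rightarrow> 'x set) \<Rightarrow> ('c \<Rightarrow> ('u \<Rightarrow> 'x) \<Rightarrow> 'k::field) \<Rightarrow> ('u \<Rightarrow> 'x) \<Rightarrow> 'k" where
  "potential_product H X \<psi> =
     (\<lambda>x\<in>joint_states H X. \<Prod>C\<in>hedges H. \<psi> C (restrict x (members H C)))"

definition normalizing_constant ::
  "('u, 'c) hypergraph \<Rightarrow> ('u \<Rightarrow> 'x set) \<Rightarrow> ('c \<Rightarrow> ('u \<Rightarrow> 'x) \<Rightarrow> 'k::field) \<Rightarrow> 'k" where
  "normalizing_constant H X \<psi> = (\<Sum>x\<in>joint_states H X. potential_product H X \<psi> x)"

definition gm_distribution ::
  "('u, 'c) hypergraph \<Rightarrow> ('u \<Rightarrow> 'x set) \<Rightarrow> ('c \<Rightarrow> ('u \<Rightarrow> 'x) \<Rightarrow> 'k::field) \<Rightarrow> ('u \<Rightarrow> 'x) \<Rightarrow> 'k" where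
  "gm_distribution H X \<psi> =
     (\<lambda>x\<in>joint_states H X. 1 / normalizing_constant H X \<psi> * potential_product H X \<psi> x)"

text \<open>
  Potentials with vanishing normalizing constant define no distribution; they have to be excluded
  explicitly because division by zero is total in HOL.
\<close>

definition graphical_model ::
  "'k::field set \<Rightarrow> ('u, 'c) hypergraph \<Rightarrow> ('u \<Rightarrow> 'x set) \<Rightarrow> (('u \<Rightarrow> 'x) \<Rightarrow> 'k) set" where
  "graphical_model S H X =
     {gm_distribution H X \<psi> | \<psi>. \<psi> \<in> clique_potentials S H X \<and> normalizing_constant H X \<psi> \<noteq> 0}"


section \<open>Tensor hypernetworks\<close>

text \<open>
  A tensor in the tensor product of the spaces of dimension \<open>n e\<close>, for \<open>e\<close> in \<open>A\<close>, is given by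
  its entries, a function on \<open>multi_indices A n\<close>.
\<close>

definition multi_indices :: "'e set \<Rightarrow> ('e \<Rightarrow> nat) \<Rightarrow> ('e \<Rightarrow> nat) set" where
  "multi_indices A n = (\<Pi>\<^sub>E e\<in>A. {1..n e})"

definition incident :: "('v, 'e) hypergraph \<Rightarrow> 'v \<Rightarrow> 'e set" where
  "incident G v = {e \<in> hedges G. v \<in> members G e}"

definition tensor_hypernetworks ::
  "'k set \<Rightarrow> ('v, 'e) hypergraph \<Rightarrow> ('e \<Rightarrow> nat) \<Rightarrow> ('v \<Rightarrow> ('e \<Rightarrow> nat) \<Rightarrow> 'k) set" where
  "tensor_hypernetworks S G n = (\<Pi> v\<in>verts G. multi_indices (incident G v) n \<rightarrow> S)"

definition noncontracted_state ::
  "('v, 'e) hypergraph \<Rightarrow> ('e \<Rightarrow> nat) \<Rightarrow> ('v \<Rightarrow> ('e \<Rightarrow> nat) \<Rightarrow> 'k::field) \<Rightarrow> ('e \<Rightarrow> nat) \<Rightarrow> 'k" where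
  "noncontracted_state G n T =
     (\<lambda>i\<in>multi_indices (hedges G) n. \<Prod>v\<in>verts G. T v (restrict i (incident G v)))"

definition hypernetwork_states ::
  "'k::field set \<Rightarrow> ('v, 'e) hypergraph \<Rightarrow> ('e \<Rightarrow> nat) \<Rightarrow> (('e \<Rightarrow> nat) \<Rightarrow> 'k) set" where
  "hypernetwork_states S G n = noncontracted_state G n ` tensor_hypernetworks S G n"


section \<open>Comparing the two sides\<close>

text \<open>
  Given an enumeration \<open>val u 1, \<dots>, val u (n u)\<close> of the values of each variable \<open>u\<close>, a function
  \<open>f\<close> of the variables in \<open>A\<close> becomes a tensor with the usual integer indices.
\<close>

definition as_tensor ::
  "('u \<Rightarrow> nat \<Rightarrow> 'x) \<Rightarrow> 'u set \<Rightarrow> ('u \<Rightarrow> nat) \<Rightarrow> (('u \<Rightarrow> 'x) \<Rightarrow> 'k) \<Rightarrow> ('u \<Rightarrow> nat) \<Rightarrow> 'k" where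
  "as_tensor val A n f = (\<lambda>i\<in>multi_indices A n. f (\<lambda>u\<in>A. val u (i u)))"

text \<open>
  The scaling class is formed among all tensors indexed by \<open>I\<close>: the set of states of a hypergraph
  without vertices consists of the all-ones tensor only and is not itself closed under scaling.
\<close>

definition scaling_class :: "'i set \<Rightarrow> ('i \<Rightarrow> 'k::field) \<Rightarrow> ('i \<Rightarrow> 'k) set" where
  "scaling_class I t = {(\<lambda>i\<in>I. c * t i) | c. c \<noteq> 0}"

end

theory Submission
  imports Defs
begin

text \<open>
  The enumerations of the \<open>X u\<close> identify the multi-indices over a set of variables with its
  joint states, and under this identification the product of potentials is literally the
  non-contracted state of the dual hypernetwork. A distribution in the graphical model is the
  member with entries summing to one of the scaling class of such a product, and a scaling class
  contains at most one such tensor. Over the nonnegative reals, the entries of a state have nonzero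
  sum as soon as one of them is nonzero.
\<close>

section \<open>Multi-indices as joint states\<close>

definition relabel :: "('u \<Rightarrow> nat \<Rightarrow> 'x) \<Rightarrow> 'u set \<Rightarrow> ('u \<Rightarrow> nat) \<Rightarrow> 'u \<Rightarrow> 'x" where
  "relabel val A i = (\<lambda>u\<in>A. val u (i u))"

text \<open>Read this way, \<open>as_tensor\<close> is precomposition with a map that turns out to
  be bijective, so equality and sums of entries carry over.\<close>

lemma as_tensor_relabel: "as_tensor val A n f = (\<lambda>i\<in>multi_indices A n. f (relabel val A i))"
  by (simp add: as_tensor_def relabel_def)

text \<open>The inverse undoes the enumeration coordinate by coordinate. The set \<open>A\<close> is
  left general because it will be both the whole vertex set and a single hyperedge.\<close>

lemma bij_betw_relabel:
  assumes "\<And>u. u \<in> A \<Longrightarrow> bij_betw (val u) {1..n u} (X u)"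
  shows "bij_betw (relabel val A) (multi_indices A n) (PiE A X)"
proof (rule bij_betw_byWitness)
  let ?g = "\<lambda>x. \<lambda>u\<in>A. inv_into {1..n u} (val u) (x u)"
  note inj = bij_betw_imp_inj_on[OF assms] and surj = bij_betw_imp_surj_on[OF assms]
  show "\<forall>i\<in>multi_indices A n. ?g (relabel val A i) = i"
    using inj by (auto simp: multi_indices_def relabel_def fun_eq_iff PiE_iff extensional_def)
  show "\<forall>x\<in>PiE A X. relabel val A (?g x) = x"
    using surj by (auto simp: relabel_def fun_eq_iff PiE_iff extensional_def f_inv_into_f)
  show "relabel val A ` multi_indices A n \<subseteq> PiE A X"
    using surj by (fastforce simp: multi_indices_def relabel_def PiE_iff)
  show "?g ` PiE A X \<subseteq> multi_indices A n"
  proof (rule image_subsetI)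
    fix x assume "x \<in> PiE A X"
    then have "inv_into {1..n u} (val u) (x u) \<in> {1..n u}" if "u \<in> A" for u
      using surj[OF that] that by (intro inv_into_into) auto
    then show "?g x \<in> multi_indices A n"
      by (auto simp: multi_indices_def)
  qed
qed

lemma verts_dual [simp]: "verts (dual H) = hedges H"
  and hedges_dual [simp]: "hedges (dual H) = verts H"
  by (simp_all add: dual_def)

text \<open>Dualizing twice returns the original incidences. Hyperedges of \<open>dual H\<close>
  range over \<open>verts H\<close> only, so the inclusion ensures that no member of
  \<open>C\<close> is lost.\<close>

lemma incident_dual: "C \<in> hedges H \<Longrightarrow> members H C \<subseteq> verts H \<Longrightarrow> incident (dual H) C = members H C"
  by (auto simp: incident_def dual_def)

lemma potential_product_extensional: "potential_product H X \<psi> \<in> extensional (PiE (verts H) X)"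
  by (simp add: potential_product_def joint_states_def)

lemma gm_distribution_extensional: "gm_distribution H X \<psi> \<in> extensional (PiE (verts H) X)"
  by (simp add: gm_distribution_def joint_states_def)

section \<open>Scaling classes\<close>

lemma scaling_class_self: "t \<in> extensional I \<Longrightarrow> t \<in> scaling_class I t"
  unfolding scaling_class_def
  by (auto simp: fun_eq_iff extensional_def intro!: exI[of _ 1])

text \<open>Nonzero scalars form a group: the factor \<open>c\<close> is absorbed by passing between
  \<open>d\<close> and \<open>d * c\<close>.\<close>

lemma scaling_class_scale:
  fixes c :: "'k::field"
  assumes "c \<noteq> 0"
  shows "scaling_class I (\<lambda>i\<in>I. c * t i) = scaling_class I t"
proof (intro set_eqI iffI)
  fix s assume "s \<in> scaling_class I (\<lambda>i\<in>I. c * t i)"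
  then obtain d where "d \<noteq> 0" "s = (\<lambda>i\<in>I. d * (\<lambda>i\<in>I. c * t i) i)"
    by (auto simp: scaling_class_def)
  then have "d * c \<noteq> 0" "s = (\<lambda>i\<in>I. (d * c) * t i)"
    using assms by (auto simp: fun_eq_iff mult.assoc)
  then show "s \<in> scaling_class I t"
    unfolding scaling_class_def by blast
next
  fix s assume "s \<in> scaling_class I t"
  then obtain d where "d \<noteq> 0" "s = (\<lambda>i\<in>I. d * t i)"
    by (auto simp: scaling_class_def)
  then have "d / c \<noteq> 0" "s = (\<lambda>i\<in>I. (d / c) * (\<lambda>i\<in>I. c * t i) i)"
    using assms by (auto simp: fun_eq_iff)
  then show "s \<in> scaling_class I (\<lambda>i\<in>I. c * t i)"
    unfolding scaling_class_def by blast
qed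

text \<open>Summing \<open>s = c * t\<close> over \<open>I\<close> forces
  \<open>c = 1\<close>.\<close>

lemma scaling_class_eq_sum_one:
  fixes s t :: "'i \<Rightarrow> 'k::field"
  assumes "scaling_class I s = scaling_class I t"
    and "s \<in> extensional I" "t \<in> extensional I" "sum s I = 1" "sum t I = 1"
  shows "s = t"
proof -
  from assms obtain c where c: "s = (\<lambda>i\<in>I. c * t i)"
    using scaling_class_self[of s I] by (auto simp: scaling_class_def)
  then have "sum s I = c * sum t I"
    by (simp add: sum_distrib_left)
  with assms c show ?thesis
    by (auto simp: fun_eq_iff extensional_def)
qed

section \<open>Potentials on a hypergraph versus tensors on its dual\<close>

locale enumerated_hypergraph =
  fixes H :: "('u, 'c) hypergraph"
    and X :: "'u \<Rightarrow> 'x set"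
    and val :: "'u \<Rightarrow> nat \<Rightarrow> 'x"
    and n :: "'u \<Rightarrow> nat"
  assumes finite_hypergraph: "finite_hypergraph H"
    and bij_val: "u \<in> verts H \<Longrightarrow> bij_betw (val u) {1..n u} (X u)"
begin

abbreviation indices :: "('u \<Rightarrow> nat) set" where
  "indices \<equiv> multi_indices (verts H) n"

abbreviation full_tensor :: "(('u \<Rightarrow> 'x) \<Rightarrow> 'k) \<Rightarrow> ('u \<Rightarrow> nat) \<Rightarrow> 'k" where
  "full_tensor \<equiv> as_tensor val (verts H) n"

abbreviation potential_tensors :: "('c \<Rightarrow> ('u \<Rightarrow> 'x) \<Rightarrow> 'k) \<Rightarrow> 'c \<Rightarrow> ('u \<Rightarrow> nat) \<Rightarrow> 'k" where
  "potential_tensors \<psi> \<equiv> (\<lambda>C. as_tensor val (members H C) n (\<psi> C))"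

lemma finite_indices: "finite indices"
  using finite_hypergraph by (auto simp: multi_indices_def finite_hypergraph_def intro: finite_PiE)

lemma members_subset: "C \<in> hedges H \<Longrightarrow> members H C \<subseteq> verts H"
  using finite_hypergraph by (auto simp: finite_hypergraph_def)

lemma bij_relabel: "A \<subseteq> verts H \<Longrightarrow> bij_betw (relabel val A) (multi_indices A n) (PiE A X)"
  by (intro bij_betw_relabel bij_val) auto

lemma relabel_in_joint_states: "i \<in> indices \<Longrightarrow> relabel val (verts H) i \<in> joint_states H X"
  using bij_betwE[OF bij_relabel[OF subset_refl]] by (simp add: joint_states_def)

text \<open>Every joint state is the relabelling of some multi-index, so the tensor determines all
  values on joint states; extensionality fixes the rest.\<close>

lemma inj_on_full_tensor: "inj_on full_tensor (extensional (PiE (verts H) X))"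
proof (rule inj_onI)
  fix f g :: "('u \<Rightarrow> 'x) \<Rightarrow> 'k"
  assume ext: "f \<in> extensional (PiE (verts H) X)" "g \<in> extensional (PiE (verts H) X)"
    and eq: "full_tensor f = full_tensor g"
  show "f = g"
  proof (rule extensionalityI[OF ext])
    fix x assume "x \<in> PiE (verts H) X"
    then obtain i where "i \<in> indices" "x = relabel val (verts H) i"
      using bij_betw_imp_surj_on[OF bij_relabel[OF subset_refl]] by blast
    then show "f x = g x"
      using fun_cong[OF eq, of i] by (simp add: as_tensor_relabel)
  qed
qed

text \<open>The products agree factor by factor, since relabelling commutes with restriction to a
  hyperedge \<open>C\<close> and \<open>C\<close> is also the set of dual hyperedges incident to the
  vertex \<open>C\<close>.\<close>

lemma full_tensor_potential_product:
  "full_tensor (potential_product H X \<psi>) = noncontracted_state (dual H) n (potential_tensors \<psi>)"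
proof -
  have "(\<Prod>C\<in>hedges H. \<psi> C (restrict (relabel val (verts H) i) (members H C))) =
      (\<Prod>C\<in>hedges H. potential_tensors \<psi> C (restrict i (incident (dual H) C)))"
    if i: "i \<in> indices" for i
  proof (rule prod.cong[OF refl])
    fix C assume C: "C \<in> hedges H"
    have "restrict (relabel val (verts H) i) (members H C) = relabel val (members H C) (restrict i (members H C))"
      using members_subset[OF C] by (auto simp: relabel_def fun_eq_iff)
    \<comment> \<open>Outside its index set \<open>as_tensor\<close> is \<open>undefined\<close>, so
      membership has to be checked.\<close>
    moreover have "restrict i (members H C) \<in> multi_indices (members H C) n"
      using i members_subset[OF C] by (auto simp: multi_indices_def)
    ultimately show "\<psi> C (restrict (relabel val (verts H) i) (members H C)) =
        potential_tensors \<psi> C (restrict i (incident (dual H) C))"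
      using C members_subset[OF C] by (simp add: incident_dual as_tensor_relabel)
  qed
  then show ?thesis
    by (auto simp: as_tensor_relabel[of _ "verts H"] noncontracted_state_def potential_product_def
        relabel_in_joint_states fun_eq_iff)
qed

text \<open>Tensors in \<open>tensor_hypernetworks\<close> are arbitrary outside their index sets,
  so a hypernetwork rebuilt from potentials matches the original one only on them.\<close>

lemma noncontracted_state_cong:
  assumes "\<And>C j. C \<in> hedges H \<Longrightarrow> j \<in> multi_indices (members H C) n \<Longrightarrow> T C j = T' C j"
  shows "noncontracted_state (dual H) n T = noncontracted_state (dual H) n T'"
  unfolding noncontracted_state_def
proof (intro restrict_ext prod.cong refl)
  fix i C assume i: "i \<in> multi_indices (hedges (dual H)) n" and "C \<in> verts (dual H)"
  then have C: "C \<in> hedges H" by simp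
  have "restrict i (members H C) \<in> multi_indices (members H C) n"
    using i members_subset[OF C] by (auto simp: multi_indices_def)
  then show "T C (restrict i (incident (dual H) C)) = T' C (restrict i (incident (dual H) C))"
    using assms C members_subset[OF C] by (simp add: incident_dual)
qed

text \<open>Potentials and tensors are transported into each other one hyperedge at a time. This
  only moves values around, so any value set \<open>S\<close> is respected.\<close>

lemma full_tensor_image:
  "full_tensor ` potential_product H X ` clique_potentials S H X = hypernetwork_states S (dual H) n"
proof (intro equalityI subsetI)
  fix t assume "t \<in> full_tensor ` potential_product H X ` clique_potentials S H X"
  then obtain \<psi> where \<psi>: "\<psi> \<in> clique_potentials S H X"
    and t: "t = noncontracted_state (dual H) n (potential_tensors \<psi>)"
    by (auto simp: full_tensor_potential_product)
  have "potential_tensors \<psi> \<in> tensor_hypernetworks S (dual H) n"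
    unfolding tensor_hypernetworks_def
  proof (intro Pi_I)
    fix C j assume "C \<in> verts (dual H)" and j: "j \<in> multi_indices (incident (dual H) C) n"
    then have C: "C \<in> hedges H" by simp
    show "potential_tensors \<psi> C j \<in> S"
      using C j \<psi> members_subset[OF C] bij_betwE[OF bij_relabel[OF members_subset[OF C]]]
      by (force simp: incident_dual as_tensor_relabel clique_potentials_def Pi_iff)
  qed
  then show "t \<in> hypernetwork_states S (dual H) n"
    by (auto simp: hypernetwork_states_def t)
next
  fix t assume "t \<in> hypernetwork_states S (dual H) n"
  then obtain T where T: "T \<in> tensor_hypernetworks S (dual H) n"
    and t: "t = noncontracted_state (dual H) n T"
    by (auto simp: hypernetwork_states_def)
  \<comment> \<open>The inverse relabelling, through which the tensor at \<open>C\<close> is pulled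
    back to a potential.\<close>
  define index where "index A = inv_into (multi_indices A n) (relabel val A)" for A
  define \<psi> where "\<psi> C x = T C (index (members H C) x)" for C x
  have "\<psi> \<in> clique_potentials S H X"
    unfolding clique_potentials_def
  proof (intro Pi_I)
    fix C x assume C: "C \<in> hedges H" and "x \<in> PiE (members H C) X"
    then have "index (members H C) x \<in> multi_indices (members H C) n"
      unfolding index_def
      using bij_betw_imp_surj_on[OF bij_relabel[OF members_subset[OF C]]] by (intro inv_into_into) simp
    with C T members_subset[OF C] show "\<psi> C x \<in> S"
      by (force simp: \<psi>_def tensor_hypernetworks_def incident_dual Pi_iff)
  qed
  moreover have "t = full_tensor (potential_product H X \<psi>)"
    unfolding t full_tensor_potential_product
  proof (rule noncontracted_state_cong)
    fix C j assume C: "C \<in> hedges H" and j: "j \<in> multi_indices (members H C) n"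
    then show "T C j = potential_tensors \<psi> C j"
      using bij_betw_imp_inj_on[OF bij_relabel[OF members_subset[OF C]]]
      by (simp add: as_tensor_relabel \<psi>_def index_def)
  qed
  ultimately show "t \<in> full_tensor ` potential_product H X ` clique_potentials S H X"
    by blast
qed

lemma bij_betw_potential_products:
  "bij_betw full_tensor (potential_product H X ` clique_potentials S H X)
     (hypernetwork_states S (dual H) n)"
  unfolding bij_betw_def full_tensor_image
  by (auto intro!: inj_on_subset[OF inj_on_full_tensor] potential_product_extensional)

section \<open>Normalization\<close>

lemma sum_full_tensor_potential_product:
  "sum (full_tensor (potential_product H X \<psi>)) indices = normalizing_constant H X \<psi>"
proof -
  have "normalizing_constant H X \<psi> =
      (\<Sum>i\<in>indices. potential_product H X \<psi> (relabel val (verts H) i))"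
    unfolding normalizing_constant_def joint_states_def
    using sum.reindex_bij_betw[OF bij_relabel[OF subset_refl]] by metis
  then show ?thesis
    by (simp add: as_tensor_relabel)
qed

lemma full_tensor_gm_distribution:
  "full_tensor (gm_distribution H X \<psi>) =
     (\<lambda>i\<in>indices. 1 / normalizing_constant H X \<psi> * full_tensor (potential_product H X \<psi>) i)"
  by (auto simp: as_tensor_relabel gm_distribution_def relabel_in_joint_states fun_eq_iff)

lemma scale_gm_distribution:
  assumes "normalizing_constant H X \<psi> \<noteq> 0"
  shows "(\<lambda>i\<in>indices. normalizing_constant H X \<psi> * full_tensor (gm_distribution H X \<psi>) i) =
    full_tensor (potential_product H X \<psi>)"
  using assms unfolding full_tensor_gm_distribution by (auto simp: as_tensor_relabel fun_eq_iff)

lemma sum_full_tensor_gm_distribution: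
  assumes "normalizing_constant H X \<psi> \<noteq> 0"
  shows "sum (full_tensor (gm_distribution H X \<psi>)) indices = 1"
proof -
  have "sum (full_tensor (gm_distribution H X \<psi>)) indices =
      1 / normalizing_constant H X \<psi> * sum (full_tensor (potential_product H X \<psi>)) indices"
    unfolding full_tensor_gm_distribution sum_distrib_left by simp
  with assms show ?thesis
    by (simp add: sum_full_tensor_potential_product)
qed

lemma bij_betw_graphical_model:
  "bij_betw (\<lambda>P. scaling_class indices (full_tensor P)) (graphical_model S H X)
     (scaling_class indices ` {t \<in> hypernetwork_states S (dual H) n. sum t indices \<noteq> 0})"
  (is "bij_betw ?f _ ?B")
proof (rule bij_betw_imageI)
  show "inj_on ?f (graphical_model S H X)"
  proof (rule inj_onI)
    fix P Q assume "P \<in> graphical_model S H X" "Q \<in> graphical_model S H X" and eq: "?f P = ?f Q"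
    then obtain \<psi> \<phi> where P: "P = gm_distribution H X \<psi>" "normalizing_constant H X \<psi> \<noteq> 0"
      and Q: "Q = gm_distribution H X \<phi>" "normalizing_constant H X \<phi> \<noteq> 0"
      by (auto simp: graphical_model_def)
    have "full_tensor P = full_tensor Q"
      by (rule scaling_class_eq_sum_one[OF eq])
        (simp_all add: P Q sum_full_tensor_gm_distribution, simp_all add: as_tensor_def)
    then show "P = Q"
      using inj_on_full_tensor by (auto simp: P Q gm_distribution_extensional dest: inj_onD)
  qed
  \<comment> \<open>Division by the nonzero normalizing constant stays within the scaling
    class.\<close>
  have "?f (gm_distribution H X \<psi>) = scaling_class indices (full_tensor (potential_product H X \<psi>))"
    if "normalizing_constant H X \<psi> \<noteq> 0" for \<psi>
    unfolding full_tensor_gm_distribution using that by (intro scaling_class_scale) simp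
  then have "?f ` graphical_model S H X =
      (\<lambda>\<psi>. scaling_class indices (full_tensor (potential_product H X \<psi>))) `
        {\<psi> \<in> clique_potentials S H X. normalizing_constant H X \<psi> \<noteq> 0}"
    by (auto simp: graphical_model_def image_iff)
  \<comment> \<open>The normalizing constant is the sum of the entries of the state, so the
    condition on potentials becomes one on states.\<close>
  also have "\<dots> = ?B"
    unfolding full_tensor_image[symmetric]
    by (auto simp: sum_full_tensor_potential_product image_iff)
  finally show "?f ` graphical_model S H X = ?B" .
qed

text \<open>Each entry is a product of nonnegative potentials, and nonnegative entries cannot cancel
  in a finite sum.\<close>

lemma nonneg_state_sum_nonzero_iff:
  fixes t :: "('u \<Rightarrow> nat) \<Rightarrow> real"
  assumes "t \<in> hypernetwork_states {0..} (dual H) n"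
  shows "sum t indices \<noteq> 0 \<longleftrightarrow> (\<exists>i\<in>indices. t i \<noteq> 0)"
proof -
  from assms obtain \<psi> :: "'c \<Rightarrow> ('u \<Rightarrow> 'x) \<Rightarrow> real"
    where \<psi>: "\<psi> \<in> clique_potentials {0..} H X" and t: "t = full_tensor (potential_product H X \<psi>)"
    unfolding full_tensor_image[symmetric] by blast
  have "0 \<le> \<psi> C (restrict x (members H C))"
    if "C \<in> hedges H" "x \<in> joint_states H X" for C x
  proof -
    have "restrict x (members H C) \<in> PiE (members H C) X"
      using that members_subset[OF that(1)] by (auto simp: joint_states_def)
    with \<psi> that(1) show ?thesis
      by (force simp: clique_potentials_def)
  qed
  then have "0 \<le> t i" if "i \<in> indices" for i
    using that relabel_in_joint_states[OF that]
    by (auto simp: t as_tensor_relabel potential_product_def intro!: prod_nonneg)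
  then show ?thesis
    by (subst sum_nonneg_eq_0_iff) (auto simp: finite_indices)
qed

end

theorem corollary2p2:
  fixes H :: "('u, 'c) hypergraph"
    and X :: "'u \<Rightarrow> 'x set"
    and val :: "'u \<Rightarrow> nat \<Rightarrow> 'x"
    and n :: "'u \<Rightarrow> nat"
    and I :: "('u \<Rightarrow> nat) set"
  assumes "finite_hypergraph H"
    and "\<And>u. u \<in> verts H \<Longrightarrow> finite (X u) \<and> X u \<noteq> {}"
    and "\<And>u. u \<in> verts H \<Longrightarrow> bij_betw (val u) {1..card (X u)} (X u)"
    and n_eq: "n = (\<lambda>u. card (X u))"
    and I_eq: "I = multi_indices (hedges (dual H)) n"
  shows "
    \<comment> \<open>nonnegative real potentials and tensors\<close>
    bij_betw (\<lambda>P. scaling_class I (as_tensor val (verts H) n P))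
      (graphical_model {0::real..} H X)
      (scaling_class I ` {t \<in> hypernetwork_states {0::real..} (dual H) n. \<exists>i\<in>I. t i \<noteq> 0}) \<and>
    \<comment> \<open>potentials and tensors over an arbitrary field\<close>
    bij_betw (\<lambda>P. scaling_class I (as_tensor val (verts H) n P))
      (graphical_model (UNIV :: 'k::field set) H X)
      (scaling_class I ` {t \<in> hypernetwork_states (UNIV :: 'k set) (dual H) n. (\<Sum>i\<in>I. t i) \<noteq> 0}) \<and>
    \<comment> \<open>the same without normalization, covering states whose entries sum to zero\<close>
    bij_betw (as_tensor val (verts H) n)
      (potential_product H X ` clique_potentials (UNIV :: 'k set) H X)
      (hypernetwork_states (UNIV :: 'k set) (dual H) n) \<and>
    \<comment> \<open>the distribution with potentials \<open>\<psi>\<close> corresponds to the hypernetwork with tensors \<open>\<psi>\<close>\<close>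
    (\<forall>\<psi> :: 'c \<Rightarrow> ('u \<Rightarrow> 'x) \<Rightarrow> 'k. normalizing_constant H X \<psi> \<noteq> 0 \<longrightarrow>
      (\<lambda>i\<in>I. normalizing_constant H X \<psi> * as_tensor val (verts H) n (gm_distribution H X \<psi>) i) =
      noncontracted_state (dual H) n (\<lambda>C. as_tensor val (members H C) n (\<psi> C)))"
proof -
  interpret enumerated_hypergraph H X val n
    using assms(1,3) by unfold_locales (simp_all add: n_eq)
  have I: "I = indices"
    by (simp add: I_eq)
  \<comment> \<open>Reduces the probabilistic case to the bijection already proved for general
    \<open>S\<close>.\<close>
  have nonneg: "{t \<in> hypernetwork_states {0::real..} (dual H) n. \<exists>i\<in>indices. t i \<noteq> 0} =
      {t \<in> hypernetwork_states {0..} (dual H) n. sum t indices \<noteq> 0}"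
    using nonneg_state_sum_nonzero_iff by blast
  show ?thesis
    unfolding I nonneg
    by (intro conjI allI impI bij_betw_graphical_model bij_betw_potential_products)
      (simp add: scale_gm_distribution full_tensor_potential_product)
qed

end
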